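(* Let $\mathcal{X}$ be the strongly connected dependency graph, with $n$ vertices $a_1,\dots,a_n$ (not counting $\varepsilon$), of a Boolean monomial system $f:\mathbb{F}_2^n\to\mathbb{F}_2^n$, where the cases $n=1$, $f=0$ and $n=1$, $f=1$ are excluded. Let $A$ be the adjacency matrix of $\mathcal{X}$ on $a_1,\dots,a_n$. Then the loop number of $\mathcal{X}$ is the greatest common divisor of the numbers $i$ with $1\le i\le n$ such that $A^i$ has at least one non-zero diagonal entry.
   Context: A Boolean monomial system is a map $f=(f_1,\ldots,f_n):\mathbb{F}_2^n\to\mathbb{F}_2^n$ where each $f_i=\alpha_i x_1^{\varepsilon_{1i}}\cdots x_n^{\varepsilon_{ni}}$ with $\alpha_i,\varepsilon_{ji}\in\{0,1\}$ (all $\varepsilon_{ji}=0$ if $\alpha_i=0$). Its dependency graph $\mathcal{X}$ is the digraph with vertex set $\{a_1,\ldots,a_n,\varepsilon\}$, with an edge $a_i\to a_j$ iff $\alpha_i=1$ and $\varepsilon_{ji}=1$, and an edge $a_i\to\varepsilon$ iff $f_i=0$. Write $a\in\mathcal{X}$ for a vertex $a\ne\varepsilon$. A walk is a directed walk (repetitions allowed), $|p|$ is its length, and the empty walk has length $0$. $\mathcal{X}$ is strongly connected if for all $a,b\in\mathcal{X}$ there is a walk from $a$ to $b$. The adjacency matrix $A$ is the $n\times n$ integer matrix with $A_{ij}=1$ if there is an edge $a_i\to a_j$ and $0$ otherwise; powers are taken over the integers, so $(A^s)_{ij}\ne0$ iff there is a walk of length $s$ from $a_i$ to $a_j$. The loop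 number of $a\in\mathcal{X}$ is the minimum of all $t\ge 1$ such that $t=|p|-|q|$ for closed walks $p,q:a\to a$; it is $0$ if there is no closed walk of positive length at $a$. On a strongly connected $\mathcal{X}$ it is the same for all vertices and is called the loop number of $\mathcal{X}$. *)

theory Defs
  imports
    "HOL-Analysis.Analysis"
    "HOL-Library.Z2"
    "Graph_Theory.Arc_Walk"
begin

text \<open>
  The field with two elements is \<^typ>\<open>bit\<close>, and the indices \<open>1, \<dots>, n\<close> are the elements of a finite
  type \<open>'n\<close>, so \<open>n = CARD('n)\<close>. The exponent of \<open>x\<^sub>j\<close> in \<open>f\<^sub>i\<close> is \<open>e j i\<close>.
\<close>

definition monomial_rep ::
    "(bit ^ 'n \<Rightarrow> bit ^ 'n) \<Rightarrow> ('n \<Rightarrow> bit) \<Rightarrow> ('n \<Rightarrow> 'n \<Rightarrow> nat) \<Rightarrow> bool" where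
  "monomial_rep f \<alpha> e \<longleftrightarrow>
     (\<forall>i j. e j i \<in> {0, 1}) \<and>
     (\<forall>i. \<alpha> i = 0 \<longrightarrow> (\<forall>j. e j i = 0)) \<and>
     (\<forall>x i. f x $ i = \<alpha> i * (\<Prod>j\<in>UNIV. (x $ j) ^ e j i))"

definition boolean_monomial_system :: "(bit ^ 'n \<Rightarrow> bit ^ 'n) \<Rightarrow> bool" where
  "boolean_monomial_system f \<longleftrightarrow> (\<exists>\<alpha> e. monomial_rep f \<alpha> e)"

text \<open>
  The coefficients and exponents are determined by the map, so the dependency graph below is
  a function of the map alone.
\<close>

lemma monomial_rep_unique:
  fixes f :: "bit ^ 'n \<Rightarrow> bit ^ 'n"
  assumes "monomial_rep f \<alpha> e" "monomial_rep f \<beta> d"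
  shows "\<alpha> = \<beta>" "e = d"
proof -
  have coeff: "\<gamma> i = f 1 $ i" if "monomial_rep f \<gamma> c" for \<gamma> c i
    using that by (simp add: monomial_rep_def)
  show ab: "\<alpha> = \<beta>"
    using coeff[OF assms(1)] coeff[OF assms(2)] by auto
  have expo: "c j i = (if f 1 $ i = f (\<chi> k. if k = j then 0 else 1) $ i then 0 else 1)"
    if c: "monomial_rep f \<gamma> c" for \<gamma> c i j
  proof -
    have "(\<Prod>k\<in>UNIV. ((\<chi> k. if k = j then 0 else (1::bit)) $ k) ^ c k i)
        = (\<Prod>k\<in>UNIV. if k = j then 0 ^ c j i else 1)"
      by (rule prod.cong) auto
    also have "\<dots> = (0 :: bit) ^ c j i"
      by (subst prod.delta) auto
    finally have "f (\<chi> k. if k = j then 0 else 1) $ i = \<gamma> i * 0 ^ c j i"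
      using c unfolding monomial_rep_def by metis
    moreover have "c j i = 0 \<or> c j i = 1" "\<gamma> i = 0 \<longrightarrow> c j i = 0"
      using c by (auto simp: monomial_rep_def)
    ultimately show ?thesis
      using coeff[OF c, of i] by auto
  qed
  show "e = d"
    by (intro ext) (simp add: expo[OF assms(1)] expo[OF assms(2)])
qed

text \<open>The vertex \<open>a\<^sub>i\<close> is \<open>Some i\<close>; the extra vertex \<open>\<epsilon>\<close> is \<open>None\<close>.\<close>

definition dependency_graph ::
    "(bit ^ 'n \<Rightarrow> bit ^ 'n) \<Rightarrow> ('n option, 'n option \<times> 'n option) pre_digraph" where
  "dependency_graph f =
     \<lparr> verts = UNIV,
       arcs = {(Some i, Some j) | i j. \<exists>\<alpha> e. monomial_rep f \<alpha> e \<and> \<alpha> i = 1 \<and> e j i = 1}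
            \<union> {(Some i, None) | i. \<forall>x. f x $ i = 0},
       tail = fst, head = snd \<rparr>"

text \<open>
  Strong connectivity ignores \<open>\<epsilon>\<close>, which has no outgoing edge. Walks may be empty, so
  a single vertex without a loop is strongly connected.
\<close>

definition strongly_connected_dep :: "('n option, 'e) pre_digraph \<Rightarrow> bool" where
  "strongly_connected_dep X \<longleftrightarrow> (\<forall>i j. \<exists>p. pre_digraph.awalk X (Some i) p (Some j))"

definition loop_number_at :: "('a, 'e) pre_digraph \<Rightarrow> 'a \<Rightarrow> nat" where
  "loop_number_at X a =
     (if \<exists>p. pre_digraph.awalk X a p a \<and> length p > 0
      then LEAST t. t \<ge> 1 \<and>
             (\<exists>p q. pre_digraph.awalk X a p a \<and> pre_digraph.awalk X a q a \<and>
                    int t = int (length p) - int (length q))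
      else 0)"

text \<open>
  The common loop number of the vertices other than \<open>\<epsilon>\<close>; meaningful only if they all agree,
  as they do in the strongly connected case.
\<close>

definition loop_number :: "('n option, 'e) pre_digraph \<Rightarrow> nat" where
  "loop_number X = (THE l. \<forall>i. loop_number_at X (Some i) = l)"

definition adjacency_matrix :: "('n option, 'e) pre_digraph \<Rightarrow> int ^ 'n ^ 'n" where
  "adjacency_matrix X = (\<chi> i j. if Some i \<rightarrow>\<^bsub>X\<^esub> Some j then 1 else 0)"

text \<open>The operation \<open>^\<close> on \<^typ>\<open>int ^ 'n ^ 'n\<close> is componentwise, hence a separate matrix power.\<close>

primrec matrix_power :: "'a::semiring_1 ^ 'n ^ 'n \<Rightarrow> nat \<Rightarrow> 'a ^ 'n ^ 'n" where
  "matrix_power A 0 = mat 1"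
| "matrix_power A (Suc k) = A ** matrix_power A k"

end

theory Submission
  imports Defs
begin

text \<open>
  The lengths of the closed walks at \<open>a\<close> form a submonoid of the natural numbers, and the least
  positive difference of elements of a submonoid is its gcd; so the loop number at \<open>a\<close> is the gcd of
  these lengths. By strong connectivity a closed walk of length \<open>k\<close> anywhere can be inserted
  into a closed walk at \<open>a\<close>, so that gcd divides \<open>k\<close>. Finally, a closed walk of length greater than
  \<open>n\<close> repeats a vertex and splits into two shorter closed walks, so only lengths up to \<open>n\<close> matter.
\<close>

text \<open>Division with remainder: reducing an element of \<open>M\<close> modulo the least
  positive difference leaves a remainder that is again a difference of two elements of
  \<open>M\<close>, so by minimality it is zero.\<close>

lemma Least_diff_eq_Gcd:
  fixes M :: "nat set"
  assumes zero: "0 \<in> M" and add: "\<And>x y. x \<in> M \<Longrightarrow> y \<in> M \<Longrightarrow> x + y \<in> M"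
    and pos: "m \<in> M" "m > 0"
  shows "(LEAST t. t \<ge> 1 \<and> (\<exists>x\<in>M. \<exists>y\<in>M. int t = int x - int y)) = Gcd M"
proof -
  define P where "P t \<longleftrightarrow> t \<ge> 1 \<and> (\<exists>x\<in>M. \<exists>y\<in>M. int t = int x - int y)" for t
  define t where "t = (LEAST t. P t)"
  have mult: "q * x \<in> M" if "x \<in> M" for q x
    using that by (induction q) (auto intro: zero add)
  \<comment> \<open>The difference \<open>m - 0\<close> shows that some \<open>t\<close> satisfies
    \<open>P\<close>, so the least one exists.\<close>
  have "P m"
    using pos zero by (force simp: P_def)
  then have "P t"
    unfolding t_def by (rule LeastI)
  then obtain u v where t: "t \<ge> 1" and uv: "u \<in> M" "v \<in> M" "int t = int u - int v"
    by (auto simp: P_def)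
  have "t dvd k" if "k \<in> M" for k
  proof (rule ccontr)
    assume "\<not> t dvd k"
    then have "k mod t \<ge> 1"
      by (simp add: dvd_eq_mod_eq_0)
    define q where "q = k div t"
    \<comment> \<open>Substituting \<open>t = u - v\<close> into \<open>k - q * t\<close> and
      collecting terms by sign leaves both sides of the subtraction in \<open>M\<close>.\<close>
    have "int (k mod t) = int (k + q * v) - int (q * u)"
    proof -
      have "int k = int q * int t + int (k mod t)"
        unfolding q_def by (metis div_mult_mod_eq of_nat_add of_nat_mult)
      then show ?thesis
        by (simp add: uv(3) algebra_simps)
    qed
    moreover have "k + q * v \<in> M" "q * u \<in> M"
      by (auto intro: add mult that uv)
    ultimately have "P (k mod t)"
      using \<open>k mod t \<ge> 1\<close> unfolding P_def by blast
    then have "t \<le> k mod t"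
      unfolding t_def by (rule Least_le)
    with t mod_less_divisor[of t k] show False
      by linarith
  qed
  then have "t dvd Gcd M"
    by (auto intro: Gcd_greatest)
  moreover have "Gcd M dvd t"
  proof -
    have "Gcd M dvd u" "Gcd M dvd v" "u = t + v"
      using uv by auto
    then show ?thesis
      by (simp add: dvd_add_left_iff)
  qed
  ultimately show ?thesis
    unfolding t_def P_def by (rule dvd_antisym)
qed

text \<open>Pigeonhole: the walk has more steps than there are vertices, so it revisits a vertex
  \<open>b\<close>. The loop at \<open>b\<close> is cut out, and what remains is still closed at
  \<open>a\<close>.\<close>

lemma relpowp_closed_split:
  fixes E :: "'a::finite \<Rightarrow> 'a \<Rightarrow> bool"
  assumes "(E ^^ k) a a" and "CARD('a) < k"
  obtains b i j where "(E ^^ i) a a" "(E ^^ j) b b" "0 < i" "0 < j" "k = i + j"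
proof -
  obtain w where w: "w 0 = a" "w k = a" and step: "\<And>i. i < k \<Longrightarrow> E (w i) (w (Suc i))"
    using assms(1) by (auto simp: relpowp_fun_conv)
  have walk: "(E ^^ (j - i)) (w i) (w j)" if "i \<le> j" "j \<le> k" for i j
    unfolding relpowp_fun_conv using that step
    by (intro exI[of _ "\<lambda>l. w (i + l)"]) auto
  \<comment> \<open>Index \<open>k\<close> is left out to avoid the trivial repetition
    \<open>w 0 = w k\<close>; thus \<open>j < k\<close> below, and the remaining closed walk has
    positive length.\<close>
  have "\<not> inj_on w {..<k}"
  proof
    assume "inj_on w {..<k}"
    then have "card {..<k} \<le> CARD('a)"
      by (rule card_inj_on_le) auto
    with assms(2) show False by simp
  qed
  then obtain i j where ij: "i < j" "j < k" "w i = w j"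
    unfolding inj_on_def by (metis lessThan_iff linorder_neqE_nat)
  have "(E ^^ (i + (k - j))) a a"
    unfolding relpowp_add using walk[of 0 i] walk[of j k] ij w by (intro relcomppI[of _ _ "w i"]) auto
  moreover have "(E ^^ (j - i)) (w i) (w i)"
    using walk[of i j] ij by simp
  ultimately show thesis
    by (rule that) (use ij in auto)
qed

text \<open>Strong induction on the length, with the base point arbitrary because the loop split off
  may sit at another vertex.\<close>

lemma dvd_closed_length:
  fixes E :: "'a::finite \<Rightarrow> 'a \<Rightarrow> bool"
  assumes short: "\<And>i b. 1 \<le> i \<Longrightarrow> i \<le> CARD('a) \<Longrightarrow> (E ^^ i) b b \<Longrightarrow> g dvd i"
    and "(E ^^ k) a a"
  shows "g dvd k"
  using assms(2)
proof (induction k arbitrary: a rule: less_induct)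
  case (less k)
  consider "k = 0" | "1 \<le> k" "k \<le> CARD('a)" | "CARD('a) < k"
    by linarith
  then show ?case
  proof cases
    case 2
    with short less.prems show ?thesis by blast
  next
    case 3
    with less.prems obtain b i j
      where "(E ^^ i) a a" "(E ^^ j) b b" "0 < i" "0 < j" "k = i + j"
      by (rule relpowp_closed_split)
    then show ?thesis
      using less.IH[of i a] less.IH[of j b] by simp
  qed simp
qed

text \<open>The right-hand side does not mention \<open>a\<close>, so this also shows that the gcd
  is the same at every vertex.\<close>

lemma Gcd_closed_lengths:
  fixes E :: "'a::finite \<Rightarrow> 'a \<Rightarrow> bool"
  assumes conn: "\<And>a b. \<exists>k. (E ^^ k) a b"
  shows "Gcd {k. (E ^^ k) a a} = Gcd {i. 1 \<le> i \<and> i \<le> CARD('a) \<and> (\<exists>b. (E ^^ i) b b)}"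
    (is "Gcd ?L = Gcd ?S")
proof (rule dvd_antisym)
  show "Gcd ?L dvd Gcd ?S"
  proof (rule Gcd_greatest)
    fix k assume "k \<in> ?S"
    then obtain b where b: "(E ^^ k) b b" by auto
    obtain r s where r: "(E ^^ r) a b" and s: "(E ^^ s) b a"
      using conn by meson
    \<comment> \<open>The round trip from \<open>a\<close> through \<open>b\<close>, without and
      with the closed walk at \<open>b\<close>: the two lengths differ by exactly
      \<open>k\<close>.\<close>
    have "(E ^^ (r + s)) a a" "(E ^^ (r + k + s)) a a"
      unfolding relpowp_add using r s b by (meson relcomppI)+
    then have "Gcd ?L dvd r + s" "Gcd ?L dvd (r + s) + k"
      by (auto simp: ac_simps intro!: Gcd_dvd)
    then show "Gcd ?L dvd k"
      using dvd_add_right_iff by blast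
  qed
  show "Gcd ?S dvd Gcd ?L"
  proof (rule Gcd_greatest)
    fix k assume "k \<in> ?L"
    then have "(E ^^ k) a a"
      by simp
    then show "Gcd ?S dvd k"
      by (rule dvd_closed_length[rotated]) (rule Gcd_dvd, blast)
  qed
qed

lemma adjacency_matrix_nonneg: "0 \<le> adjacency_matrix X $ i $ j"
  by (simp add: adjacency_matrix_def)

lemma adjacency_matrix_nonzero: "adjacency_matrix X $ i $ j \<noteq> 0 \<longleftrightarrow> Some i \<rightarrow>\<^bsub>X\<^esub> Some j"
  by (simp add: adjacency_matrix_def)

lemma matrix_power_adjacency_nonneg: "0 \<le> matrix_power (adjacency_matrix X) k $ i $ j"
  by (induction k arbitrary: i)
    (auto simp: mat_def matrix_matrix_mult_def adjacency_matrix_nonneg intro!: sum_nonneg)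

text \<open>All entries are nonnegative, so the sum in a matrix product cannot cancel: it is
  non-zero as soon as one summand is.\<close>

lemma matrix_power_adjacency_nonzero:
  "matrix_power (adjacency_matrix X) k $ i $ j \<noteq> 0 \<longleftrightarrow>
     ((\<lambda>i j. Some i \<rightarrow>\<^bsub>X\<^esub> Some j) ^^ k) i j"
proof (induction k arbitrary: i)
  case 0
  show ?case by (simp add: mat_def)
next
  case (Suc k)
  have "matrix_power (adjacency_matrix X) (Suc k) $ i $ j \<noteq> 0 \<longleftrightarrow>
      (\<exists>m. adjacency_matrix X $ i $ m * matrix_power (adjacency_matrix X) k $ m $ j \<noteq> 0)"
    unfolding matrix_power.simps matrix_matrix_mult_def vec_lambda_beta
    by (subst sum_nonneg_eq_0_iff)
      (auto intro: matrix_power_adjacency_nonneg intro!: mult_nonneg_nonneg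
        simp: adjacency_matrix_nonneg)
  also have "\<dots> \<longleftrightarrow> (\<exists>m. Some i \<rightarrow>\<^bsub>X\<^esub> Some m \<and> ((\<lambda>i j. Some i \<rightarrow>\<^bsub>X\<^esub> Some j) ^^ k) m j)"
    by (simp add: adjacency_matrix_nonzero Suc.IH)
  also have "\<dots> \<longleftrightarrow> ((\<lambda>i j. Some i \<rightarrow>\<^bsub>X\<^esub> Some j) ^^ Suc k) i j"
    by (auto simp: relpowp_Suc_left simp del: relpowp.simps)
  finally show ?case .
qed

text \<open>Passes from arc lists on \<open>'n option\<close> to relation powers on
  \<open>'n\<close>. Nothing is lost, since a walk that enters \<open>None\<close> cannot leave
  it.\<close>

lemma awalk_relpowp_iff:
  assumes V: "verts X = UNIV" and sink: "\<forall>e\<in>arcs X. tail X e \<noteq> None"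
  shows "(\<exists>p. pre_digraph.awalk X (Some i) p (Some j) \<and> length p = k) \<longleftrightarrow>
    ((\<lambda>i j. Some i \<rightarrow>\<^bsub>X\<^esub> Some j) ^^ k) i j"
proof (induction k arbitrary: i)
  case 0
  show ?case by (auto simp: pre_digraph.awalk_def pre_digraph.cas.simps V)
next
  case (Suc k)
  have cons: "pre_digraph.awalk X u (e # p) v \<longleftrightarrow>
      e \<in> arcs X \<and> tail X e = u \<and> pre_digraph.awalk X (head X e) p v" for u e p v
    by (auto simp: pre_digraph.awalk_def pre_digraph.cas.simps V)
  \<comment> \<open>An empty walk would end at \<open>None\<close>, and the first arc of a nonempty
    one would have tail \<open>None\<close>.\<close>
  have None: "\<not> pre_digraph.awalk X None p (Some j)" for p
    using sink by (cases p) (auto simp: cons, auto simp: pre_digraph.awalk_def pre_digraph.cas.simps)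
  have "(\<exists>p. pre_digraph.awalk X (Some i) p (Some j) \<and> length p = Suc k) \<longleftrightarrow>
      (\<exists>e p. e \<in> arcs X \<and> tail X e = Some i \<and> pre_digraph.awalk X (head X e) p (Some j) \<and> length p = k)"
  proof
    assume "\<exists>p. pre_digraph.awalk X (Some i) p (Some j) \<and> length p = Suc k"
    then show "\<exists>e p. e \<in> arcs X \<and> tail X e = Some i \<and>
        pre_digraph.awalk X (head X e) p (Some j) \<and> length p = k"
      by (auto simp: length_Suc_conv cons) blast
  next
    assume "\<exists>e p. e \<in> arcs X \<and> tail X e = Some i \<and>
        pre_digraph.awalk X (head X e) p (Some j) \<and> length p = k"
    then show "\<exists>p. pre_digraph.awalk X (Some i) p (Some j) \<and> length p = Suc k"
      by (metis cons length_Cons)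
  qed
  also have "\<dots> \<longleftrightarrow> (\<exists>m. Some i \<rightarrow>\<^bsub>X\<^esub> Some m \<and>
      (\<exists>p. pre_digraph.awalk X (Some m) p (Some j) \<and> length p = k))" (is "?l = ?r")
  proof
    assume ?l
    then obtain e p where e: "e \<in> arcs X" "tail X e = Some i"
      and p: "pre_digraph.awalk X (head X e) p (Some j)" "length p = k" by blast
    with None obtain m where m: "head X e = Some m" by (cases "head X e") auto
    with e have "Some i \<rightarrow>\<^bsub>X\<^esub> Some m"
      by (force simp: arcs_ends_def arc_to_ends_def)
    with m p show ?r by auto
  next
    assume ?r
    then show ?l by (auto simp: arcs_ends_def arc_to_ends_def) metis
  qed
  also have "\<dots> \<longleftrightarrow> ((\<lambda>i j. Some i \<rightarrow>\<^bsub>X\<^esub> Some j) ^^ Suc k) i j"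
    by (auto simp: Suc.IH relpowp_Suc_left simp del: relpowp.simps)
  finally show ?case .
qed

lemma loop_number_at_eq_Gcd:
  assumes "verts X = UNIV" and "\<forall>e\<in>arcs X. tail X e \<noteq> None"
  shows "loop_number_at X (Some a) = Gcd {k. ((\<lambda>i j. Some i \<rightarrow>\<^bsub>X\<^esub> Some j) ^^ k) a a}"
    (is "_ = Gcd ?L")
proof -
  have walk: "(\<exists>p. pre_digraph.awalk X (Some a) p (Some a) \<and> length p = k) \<longleftrightarrow> k \<in> ?L" for k
    using awalk_relpowp_iff[OF assms] by simp
  have pos: "(\<exists>p. pre_digraph.awalk X (Some a) p (Some a) \<and> length p > 0) \<longleftrightarrow> (\<exists>k\<in>?L. k > 0)"
    unfolding Bex_def walk[symmetric] by blast
  have diff: "(\<exists>p q. pre_digraph.awalk X (Some a) p (Some a) \<and>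
        pre_digraph.awalk X (Some a) q (Some a) \<and> int t = int (length p) - int (length q)) \<longleftrightarrow>
      (\<exists>x\<in>?L. \<exists>y\<in>?L. int t = int x - int y)" for t
    unfolding Bex_def walk[symmetric] by blast
  show ?thesis
  proof (cases "\<exists>k\<in>?L. k > 0")
    case True
    then obtain m where m: "m \<in> ?L" "m > 0" by blast
    have "(LEAST t. t \<ge> 1 \<and> (\<exists>x\<in>?L. \<exists>y\<in>?L. int t = int x - int y)) = Gcd ?L"
      \<comment> \<open>Closure of the lengths under addition is concatenation of closed
        walks.\<close>
      by (rule Least_diff_eq_Gcd[OF _ _ m]) (auto simp: relpowp_add)
    with True show ?thesis
      unfolding loop_number_at_def pos diff by simp
  next
    case False
    \<comment> \<open>Only the empty walk is closed here, and the gcd of \<open>{0}\<close> agrees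
      with the default value in \<open>loop_number_at\<close>.\<close>
    then have "Gcd ?L = 0"
      by (auto simp: Gcd_0_iff)
    then show ?thesis
      unfolding loop_number_at_def pos if_not_P[OF False] by simp
  qed
qed

theorem theorem4p13:
  fixes f :: "bit ^ 'n \<Rightarrow> bit ^ 'n"
  assumes "boolean_monomial_system f"
    and "strongly_connected_dep (dependency_graph f)"
    and "\<not> (CARD('n) = 1 \<and> f = (\<lambda>_. 0))"
    and "\<not> (CARD('n) = 1 \<and> f = (\<lambda>_. 1))"
  shows "loop_number (dependency_graph f) =
    Gcd {i. 1 \<le> i \<and> i \<le> CARD('n) \<and>
            (\<exists>k. matrix_power (adjacency_matrix (dependency_graph f)) i $ k $ k \<noteq> 0)}"
proof -
  let ?X = "dependency_graph f"
  have X: "verts ?X = UNIV" "\<forall>e\<in>arcs ?X. tail ?X e \<noteq> None"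
    by (auto simp: dependency_graph_def)
  have "\<exists>k. ((\<lambda>i j. Some i \<rightarrow>\<^bsub>?X\<^esub> Some j) ^^ k) a b" for a b
    using assms(2) awalk_relpowp_iff[OF X] unfolding strongly_connected_dep_def by blast
  then have "loop_number_at ?X (Some a) =
      Gcd {i. 1 \<le> i \<and> i \<le> CARD('n) \<and> (\<exists>k. matrix_power (adjacency_matrix ?X) i $ k $ k \<noteq> 0)}" for a
    unfolding loop_number_at_eq_Gcd[OF X] matrix_power_adjacency_nonzero
    by (rule Gcd_closed_lengths)
  \<comment> \<open>The value is the same for every \<open>a\<close>, so the definite description in
    \<open>loop_number\<close> picks it out.\<close>
  then show ?thesis
    unfolding loop_number_def by simp
qed

end
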